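(* For all positive integers $n,t$, $\mathrm{Ehr}_{P_n}(t)=\mathrm{Ehr}_{Q_n}(t)=(t+1)^n-t^n$.
   Context: Let $\Omega$ be the $n\times n$ matrix with $(i,j)$-entry $j\binom{i+1}{j+1}$, and let $P_n\subseteq\mathbb{R}^n$ be the convex hull of the rows of $\Omega$. Let $Q_n\subseteq\mathbb{R}^n$ be the convex hull of the points $\lambda^l=(1,2,\dots,l,0,\dots,0)$ for $l\in[n]$. For a polytope $P\subseteq\mathbb{R}^d$ and $t\in\mathbb{N}$, $\mathrm{Ehr}_P(t)$ is the number of points of $\mathbb{Z}^d$ in the dilation $tP=\{tx: x\in P\}$. *)

theory Defs
  imports "HOL-Analysis.Analysis"
begin

text \<open>
  The ambient space of dimension \<open>n\<close> is \<open>real ^ 'n\<close>. Since the coordinates are given by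
  formulas in \<open>{1..n}\<close>, each object takes an enumeration \<open>idx :: 'n \<Rightarrow> nat\<close> of the coordinates,
  meant to be a bijection onto \<open>{1..n}\<close>: \<open>idx i\<close> is the position of coordinate \<open>i\<close>.
\<close>

definition Omega :: "('n::finite \<Rightarrow> nat) \<Rightarrow> real ^ 'n ^ 'n" where
  "Omega idx = (\<chi> i j. real (idx j * ((idx i + 1) choose (idx j + 1))))"

definition P_poly :: "('n::finite \<Rightarrow> nat) \<Rightarrow> (real ^ 'n) set" where
  "P_poly idx = convex hull (rows (Omega idx))"

definition lam :: "('n::finite \<Rightarrow> nat) \<Rightarrow> nat \<Rightarrow> real ^ 'n" where
  "lam idx l = (\<chi> j. if idx j \<le> l then real (idx j) else 0)"

definition Q_poly :: "('n::finite \<Rightarrow> nat) \<Rightarrow> (real ^ 'n) set" where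
  "Q_poly idx = convex hull (lam idx ` {1..CARD('n)})"

definition Ehr :: "(real ^ 'd) set \<Rightarrow> nat \<Rightarrow> nat" where
  "Ehr P t = card {x \<in> (\<lambda>y. real t *\<^sub>R y) ` P. \<forall>i. x $ i \<in> \<int>}"

end

theory Submission
  imports Defs
begin

text \<open>
  In row-vector notation \<open>P\<^sub>n = Q\<^sub>n U\<close> with \<open>U\<^sub>k\<^sub>j = (k - 1 choose j - 1)\<close>: this follows from
  \<open>j (k choose j) = k (k - 1 choose j - 1)\<close> and the hockey-stick identity. As \<open>U\<close> is integral and
  unitriangular, \<open>P\<^sub>n\<close> and \<open>Q\<^sub>n\<close> have the same Ehrhart function.

  The lattice points of \<open>t Q\<^sub>n\<close> are the integer sequences with
  \<open>t = x\<^sub>1 \<ge> x\<^sub>2 / 2 \<ge> \<dots> \<ge> x\<^sub>n / n \<ge> 0\<close>. Relaxing \<open>t = x\<^sub>1\<close> to \<open>t \<ge> x\<^sub>1\<close> gives a count \<open>F(t, n)\<close>, and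
  the number sought is \<open>F(t, n) - F(t - 1, n)\<close>. The indices with \<open>x\<^sub>j \<ge> j\<close> form an initial segment
  \<open>1, \<dots>, a\<close>; subtracting \<open>j\<close> from \<open>x\<^sub>j\<close> there leaves a sequence counted by \<open>F(t - 1, a)\<close>. For
  \<open>j > a\<close>, where \<open>x\<^sub>j < j\<close>, the condition on the ratios just says that
  \<open>a \<ge> x\<^bsub>a+1\<^esub> \<ge> \<dots> \<ge> x\<^sub>n \<ge> 0\<close>, which has \<open>(n choose a)\<close> solutions. So
  \<open>F(t, n) = \<Sum>\<^sub>a (n choose a) F(t - 1, a)\<close>, and \<open>F(t, n) = (t + 1)\<^sup>n\<close> by the binomial theorem.
\<close>

section \<open>Enumeration of anti-lecture hall sequences\<close>

text \<open>
  The sequence is \<open>x\<^sub>1, \<dots>, x\<^sub>n\<close>, padded by zeros. The bound forces \<open>x\<^sub>0 = 0\<close>, and for \<open>j > 1\<close> it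
  follows from the case \<open>j = 1\<close>.
\<close>

definition anti_lecture_hall :: "nat \<Rightarrow> nat \<Rightarrow> (nat \<Rightarrow> nat) set" where
  "anti_lecture_hall t n =
    {x. (\<forall>j>n. x j = 0) \<and> (\<forall>j. x j \<le> j * t) \<and> (\<forall>j. j * x (Suc j) \<le> Suc j * x j)}"

text \<open>Here the indices start at 0.\<close>

definition decreasing_seqs :: "nat \<Rightarrow> nat \<Rightarrow> (nat \<Rightarrow> nat) set" where
  "decreasing_seqs m a = {w. (\<forall>j\<ge>m. w j = 0) \<and> (\<forall>j. w j \<le> a) \<and> (\<forall>j. w (Suc j) \<le> w j)}"

lemma finite_bounded_seqs:
  "finite {x :: nat \<Rightarrow> nat. (\<forall>j\<ge>m. x j = 0) \<and> (\<forall>j. x j \<le> b)}"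
proof (rule finite_subset)
  show "{x :: nat \<Rightarrow> nat. (\<forall>j\<ge>m. x j = 0) \<and> (\<forall>j. x j \<le> b)}
      \<subseteq> {f. \<forall>j. (j \<in> {..<m} \<longrightarrow> f j \<in> {..b}) \<and> (j \<notin> {..<m} \<longrightarrow> f j = 0)}"
    by auto
  show "finite {f :: nat \<Rightarrow> nat. \<forall>j. (j \<in> {..<m} \<longrightarrow> f j \<in> {..b}) \<and> (j \<notin> {..<m} \<longrightarrow> f j = 0)}"
    by (rule finite_set_of_finite_funs) auto
qed

lemma finite_decreasing_seqs: "finite (decreasing_seqs m a)"
  by (rule finite_subset[OF _ finite_bounded_seqs[of m a]]) (auto simp: decreasing_seqs_def)

lemma finite_anti_lecture_hall: "finite (anti_lecture_hall t n)"
proof (rule finite_subset[OF _ finite_bounded_seqs[of "Suc n" "n * t"]], safe)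
  fix x j assume x: "x \<in> anti_lecture_hall t n"
  show "x j = 0" if "Suc n \<le> j"
    using x that by (auto simp: anti_lecture_hall_def)
  show "x j \<le> n * t"
  proof (cases "j \<le> n")
    case True
    have "x j \<le> j * t" using x by (auto simp: anti_lecture_hall_def)
    also have "\<dots> \<le> n * t" using True by simp
    finally show ?thesis .
  qed (use x in \<open>auto simp: anti_lecture_hall_def\<close>)
qed

text \<open>Pascal's rule: for positive \<open>m\<close> and \<open>a\<close>, a sequence with first
  entry \<open>a\<close> is \<open>a\<close> followed by a member of
  \<open>decreasing_seqs (m - 1) a\<close>, and every other sequence is bounded by
  \<open>a - 1\<close>.\<close>

lemma card_decreasing_seqs: "card (decreasing_seqs m a) = (m + a) choose m"
proof (induction "m + a" arbitrary: m a)
  case 0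
  then have "decreasing_seqs m a = {\<lambda>_. 0}" by (auto simp: decreasing_seqs_def)
  with 0 show ?case by simp
next
  case (Suc s)
  show ?case
  proof (cases "m = 0 \<or> a = 0")
    case True
    then have "decreasing_seqs m a = {\<lambda>_. 0}" by (auto simp: decreasing_seqs_def)
    with True show ?thesis by auto
  next
    case False
    then obtain m' a' where [simp]: "m = Suc m'" "a = Suc a'"
      by (metis not0_implies_Suc)
    let ?g = "case_nat a :: (nat \<Rightarrow> nat) \<Rightarrow> nat \<Rightarrow> nat"
    have inj: "inj_on ?g (decreasing_seqs m' a)"
      by (rule inj_onI) (metis nat.case(2) ext)
    have "decreasing_seqs m a = decreasing_seqs m a' \<union> ?g ` decreasing_seqs m' a" (is "?L = ?R")
    proof
      show "?L \<subseteq> ?R"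
      proof
        fix w assume w: "w \<in> ?L"
        have anti: "w j \<le> w 0" for j
          by (rule lift_Suc_antimono_le[of w]) (use w in \<open>auto simp: decreasing_seqs_def\<close>)
        show "w \<in> ?R"
        proof (cases "w 0 = a")
          case True
          have "w = ?g (\<lambda>j. w (Suc j))"
            using True by (auto simp: fun_eq_iff split: nat.split)
          moreover have "(\<lambda>j. w (Suc j)) \<in> decreasing_seqs m' a"
            using w by (auto simp: decreasing_seqs_def)
          ultimately show ?thesis by blast
        next
          case False
          then have "w 0 \<le> a'" using w by (auto simp: decreasing_seqs_def le_Suc_eq)
          then have "w j \<le> a'" for j using anti[of j] by simp
          then show ?thesis using w by (auto simp: decreasing_seqs_def)
        qed
      qed
      show "?R \<subseteq> ?L"
        by (auto simp: decreasing_seqs_def le_SucI split: nat.split)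
    qed
    moreover have "decreasing_seqs m a' \<inter> ?g ` decreasing_seqs m' a = {}"
      by (auto simp: decreasing_seqs_def dest!: spec[of _ 0])
    moreover have "card (?g ` decreasing_seqs m' a) = card (decreasing_seqs m' a)"
      by (rule card_image[OF inj])
    ultimately have "card (decreasing_seqs m a)
        = card (decreasing_seqs m a') + card (decreasing_seqs m' a)"
      by (simp add: card_Un_disjoint finite_decreasing_seqs)
    then show ?thesis using Suc.hyps(1)[of m a'] Suc.hyps(1)[of m' a] Suc.hyps(2) by simp
  qed
qed

lemma card_anti_lecture_hall_Suc:
  "card (anti_lecture_hall (Suc t) n) = (\<Sum>a\<le>n. (n choose a) * card (anti_lecture_hall t a))"
proof -
  \<comment> \<open>Inverse of the splitting at \<open>a\<close>: \<open>j\<close> is added back up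
    to position \<open>a\<close>, and \<open>w\<close>, indexed from 0, fills the positions from
    \<open>Suc a\<close> on.\<close>
  define glue :: "nat \<Rightarrow> (nat \<Rightarrow> nat) \<times> (nat \<Rightarrow> nat) \<Rightarrow> nat \<Rightarrow> nat" where
    "glue a = (\<lambda>(y, w) j. if j \<le> a then y j + j else w (j - Suc a))" for a
  define S where "S a = glue a ` (anti_lecture_hall t a \<times> decreasing_seqs (n - a) a)" for a
  have inj: "inj_on (glue a) (anti_lecture_hall t a \<times> decreasing_seqs (n - a) a)" for a
  proof (rule inj_onI, clarsimp)
    fix y w y' w'
    assume y: "y \<in> anti_lecture_hall t a" "y' \<in> anti_lecture_hall t a"
      and eq: "glue a (y, w) = glue a (y', w')"
    have "y j = y' j" for j
      using fun_cong[OF eq, of j] y by (cases "j \<le> a") (auto simp: glue_def anti_lecture_hall_def)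
    moreover have "w j = w' j" for j
      using fun_cong[OF eq, of "j + Suc a"] by (simp add: glue_def)
    ultimately show "y = y' \<and> w = w'" by auto
  qed
  \<comment> \<open>Together these determine \<open>a\<close> from \<open>x\<close>, so the pieces
    \<open>S a\<close> are disjoint.\<close>
  have ge: "x \<in> S a \<Longrightarrow> j \<le> a \<Longrightarrow> j \<le> x j"
    and lt: "x \<in> S a \<Longrightarrow> a < j \<Longrightarrow> x j < j" for x a j
    by (auto simp: S_def glue_def decreasing_seqs_def intro: le_less_trans[of _ a])
  have disj: "S a \<inter> S b = {}" if "a < b" for a b
    using lt[of _ a b] ge[of _ b b] that by (force simp: not_less[symmetric])
  have sub: "S a \<subseteq> anti_lecture_hall (Suc t) n" if "a \<le> n" for a
  proof
    fix x assume "x \<in> S a"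
    then obtain y w where y: "y \<in> anti_lecture_hall t a" and w: "w \<in> decreasing_seqs (n - a) a"
      and x: "x = glue a (y, w)" by (auto simp: S_def)
    have "j * x (Suc j) \<le> Suc j * x j" for j
    proof -
      consider "j < a" | "j = a" | "j > a" by linarith
      then show ?thesis
      proof cases
        case 1
        then show ?thesis using y
          by (auto simp: x glue_def anti_lecture_hall_def algebra_simps)
      next
        case 2
        \<comment> \<open>At the junction, \<open>w 0 <= a <= y a + a\<close>.\<close>
        have "w 0 \<le> a" using w by (auto simp: decreasing_seqs_def)
        then have "j * w 0 \<le> Suc j * (y j + j)"
          using 2 by (intro mult_le_mono) auto
        then show ?thesis using 2 by (simp add: x glue_def)
      next
        case 3
        then have "w (j - a) \<le> w (j - Suc a)"
          using w by (auto simp: decreasing_seqs_def Suc_diff_Suc dest: spec[of _ "j - Suc a"])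
        then show ?thesis using 3 by (auto simp: x glue_def simp del: mult_Suc intro!: mult_le_mono)
      qed
    qed
    moreover have "x j \<le> j * Suc t" for j
    proof (cases "j \<le> a")
      case True
      then show ?thesis using y by (auto simp: x glue_def anti_lecture_hall_def)
    next
      case False
      then have "x j \<le> j" using lt[OF \<open>x \<in> S a\<close>, of j] by simp
      then show ?thesis by (simp add: trans_le_add1)
    qed
    moreover have "x j = 0" if "j > n" for j
      using w that \<open>a \<le> n\<close> by (auto simp: x glue_def decreasing_seqs_def)
    ultimately show "x \<in> anti_lecture_hall (Suc t) n" by (auto simp: anti_lecture_hall_def)
  qed
  have sup: "\<exists>a\<le>n. x \<in> S a" if x: "x \<in> anti_lecture_hall (Suc t) n" for x
  proof -
    have chain: "j * x (Suc j) \<le> Suc j * x j" and zero: "n < j \<Longrightarrow> x j = 0"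
      and bd: "x j \<le> j * Suc t" for j
      using x by (auto simp: anti_lecture_hall_def)
    \<comment> \<open>If \<open>x (Suc j) >= Suc j\<close>, the chain condition would give
      \<open>x j >= j\<close>.\<close>
    have step: "x (Suc j) < Suc j" if "x j < j" for j
    proof (rule ccontr)
      assume "\<not> x (Suc j) < Suc j"
      then have "j * Suc j \<le> j * x (Suc j)" by (intro mult_le_mono2) simp
      also have "\<dots> \<le> Suc j * x j" by (rule chain)
      finally have "Suc j * j \<le> Suc j * x j" by (simp add: mult.commute)
      then show False using that by (simp only: mult_le_cancel1) auto
    qed
    have small: "x k < k" if "x j < j" "j \<le> k" for j k
      using that(2,1) by (induction k rule: dec_induct) (auto intro: step)
    \<comment> \<open>The cut exists and is at most \<open>n\<close> because
      \<open>x (Suc n) = 0\<close>. The shift by \<open>Suc\<close> skips index 0, where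
      \<open>x 0 < 0\<close> is impossible.\<close>
    define a where "a = (LEAST a. x (Suc a) < Suc a)"
    have a: "x (Suc a) < Suc a" unfolding a_def by (rule LeastI[of _ n]) (simp add: zero)
    have "a \<le> n" unfolding a_def by (rule Least_le) (simp add: zero)
    have big: "j \<le> x j" if "j \<le> a" for j
      using not_less_Least[of "j - 1" "\<lambda>a. x (Suc a) < Suc a", folded a_def] that
      by (cases j) auto
    define y where "y j = (if j \<le> a then x j - j else 0)" for j
    define w where "w j = x (j + Suc a)" for j
    \<comment> \<open>A rise at \<open>j\<close> would force
      \<open>j * (x j + 1) <= (j + 1) * x j\<close>, hence \<open>j <= x j\<close>, which fails
      beyond the cut.\<close>
    have dec: "x (Suc j) \<le> x j" if "a < j" for j
    proof (rule ccontr)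
      assume "\<not> x (Suc j) \<le> x j"
      then have "j * Suc (x j) \<le> j * x (Suc j)" by (intro mult_le_mono2) simp
      also have "\<dots> \<le> Suc j * x j" by (rule chain)
      finally have "j \<le> x j" by simp
      then show False using small[OF a, of j] that by simp
    qed
    have wdec: "w (Suc j) \<le> w j" for j using dec[of "j + Suc a"] by (simp add: w_def)
    have "w j \<le> a" for j
    proof -
      have "w j \<le> w 0" by (rule lift_Suc_antimono_le[of w]) (auto intro: wdec)
      then show ?thesis using a by (simp add: w_def)
    qed
    then have "w \<in> decreasing_seqs (n - a) a"
      using wdec by (auto simp: decreasing_seqs_def w_def intro: zero)
    moreover have "y \<in> anti_lecture_hall t a"
    proof -
      have "j * y (Suc j) \<le> Suc j * y j" for j
      proof (cases "Suc j \<le> a")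
        case True
        then show ?thesis using chain[of j]
          by (simp only: y_def diff_mult_distrib2) (simp add: algebra_simps)
      qed (simp add: y_def)
      moreover have "y j \<le> j * t" for j using bd[of j] by (auto simp: y_def)
      ultimately show ?thesis by (auto simp: anti_lecture_hall_def y_def)
    qed
    moreover have "x = glue a (y, w)"
      using big by (auto simp: glue_def y_def w_def fun_eq_iff)
    ultimately show ?thesis using \<open>a \<le> n\<close> by (auto simp: S_def)
  qed
  have "anti_lecture_hall (Suc t) n = (\<Union>a\<in>{..n}. S a)"
    using sub sup by blast
  then have "card (anti_lecture_hall (Suc t) n) = (\<Sum>a\<le>n. card (S a))"
    by (simp only:, intro card_UN_disjoint)
       (auto simp: S_def finite_anti_lecture_hall finite_decreasing_seqs
             dest!: disj[unfolded S_def] elim: linorder_neqE_nat)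
  also have "\<dots> = (\<Sum>a\<le>n. (n choose a) * card (anti_lecture_hall t a))"
  proof (rule sum.cong)
    fix a assume "a \<in> {..n}"
    then show "card (S a) = (n choose a) * card (anti_lecture_hall t a)"
      by (simp add: S_def card_image[OF inj] card_cartesian_product card_decreasing_seqs
          binomial_symmetric[of a n])
  qed simp
  finally show ?thesis .
qed

lemma card_anti_lecture_hall: "card (anti_lecture_hall t n) = (t + 1) ^ n"
proof (induction t arbitrary: n)
  case 0
  have "anti_lecture_hall 0 n = {\<lambda>_. 0}" by (auto simp: anti_lecture_hall_def)
  then show ?case by simp
next
  case (Suc t)
  show ?case
    by (simp add: card_anti_lecture_hall_Suc Suc binomial[of "Suc t" 1 n, simplified] add.commute)
qed

text \<open>The ratios \<open>x j / j\<close> decrease from \<open>j = 1\<close> on. The chain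
  condition does not constrain \<open>x 0\<close>, so its value is assumed separately.\<close>

lemma le_times_first:
  fixes x :: "nat \<Rightarrow> nat"
  assumes "\<And>j. j * x (Suc j) \<le> Suc j * x j" and "x 0 = 0"
  shows "x j \<le> j * x 1"
proof (induction j)
  case (Suc j)
  show ?case
  proof (cases "j = 0")
    case False
    have "j * x (Suc j) \<le> Suc j * x j" by (rule assms)
    also have "\<dots> \<le> Suc j * (j * x 1)" using Suc by (intro mult_le_mono2)
    finally have "j * x (Suc j) \<le> j * (Suc j * x 1)" by (simp only: mult.left_commute)
    with False show ?thesis by (simp only: mult_le_cancel1)
  qed simp
qed (use assms in simp)

text \<open>By \<open>le_times_first\<close>, the sequences with first entry at most
  \<open>t - 1\<close> are exactly those counted for \<open>t - 1\<close>; subtracting them leaves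
  first entry \<open>t\<close>.\<close>

lemma card_anti_lecture_hall_tight:
  assumes "n \<ge> 1" "t \<ge> 1"
  shows "card {x \<in> anti_lecture_hall t n. x 1 = t} = (t + 1) ^ n - t ^ n"
proof -
  obtain s where s: "t = Suc s" using \<open>t \<ge> 1\<close> by (cases t) auto
  have "{x \<in> anti_lecture_hall t n. x 1 = t} = anti_lecture_hall t n - anti_lecture_hall s n"
  proof (intro set_eqI iffI)
    fix x assume "x \<in> {x \<in> anti_lecture_hall t n. x 1 = t}"
    then show "x \<in> anti_lecture_hall t n - anti_lecture_hall s n"
      by (auto simp: anti_lecture_hall_def s intro!: exI[of _ 1])
  next
    fix x assume x: "x \<in> anti_lecture_hall t n - anti_lecture_hall s n"
    have *: "x 0 = 0" "x 1 \<le> t" "\<forall>j. j * x (Suc j) \<le> Suc j * x j" "\<forall>j>n. x j = 0"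
      using x by (auto simp: anti_lecture_hall_def dest: spec[of _ 0] spec[of _ 1])
    have "\<not> x 1 \<le> s"
    proof
      assume "x 1 \<le> s"
      then have "x j \<le> j * s" for j
        using le_times_first[of x j] * by (meson le_trans mult_le_mono2)
      with * have "x \<in> anti_lecture_hall s n" by (auto simp: anti_lecture_hall_def)
      with x show False by blast
    qed
    with *(2) x show "x \<in> {x \<in> anti_lecture_hall t n. x 1 = t}" by (auto simp: s)
  qed
  moreover have "anti_lecture_hall s n \<subseteq> anti_lecture_hall t n"
    by (auto simp: anti_lecture_hall_def s intro: le_trans)
  ultimately show ?thesis
    by (simp add: card_Diff_subset finite_anti_lecture_hall card_anti_lecture_hall s)
qed

section \<open>Lattice points in dilates of \<open>Q_poly\<close>\<close>

text \<open>In \<open>lam idx l\<close> the ratio of entry to position is 1 up to \<open>l\<close>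
  and 0 afterwards, so the generators satisfy these conditions; the conditions define a convex set,
  which then contains the hull.\<close>

lemma Q_poly_inequalities:
  fixes idx :: "'n::finite \<Rightarrow> nat"
  assumes bij: "bij_betw idx UNIV {1..CARD('n)}" and v: "v \<in> Q_poly idx"
  shows "0 \<le> v $ j" "idx j = 1 \<Longrightarrow> v $ j = 1"
    "idx k = Suc (idx j) \<Longrightarrow> real (idx j) * v $ k \<le> real (idx k) * v $ j"
proof -
  have bounds: "1 \<le> idx j" for j using bij_betwE[OF bij] by simp
  define C where "C = {v :: real^'n. (\<forall>j. 0 \<le> v $ j) \<and> (\<forall>j. idx j = 1 \<longrightarrow> v $ j = 1)
      \<and> (\<forall>j k. idx k = Suc (idx j) \<longrightarrow> real (idx j) * v $ k \<le> real (idx k) * v $ j)}"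
  have "convex C"
  proof (rule convexI)
    fix x y and a b :: real
    assume x: "x \<in> C" and y: "y \<in> C" and ab: "0 \<le> a" "0 \<le> b" "a + b = 1"
    have "real (idx j) * (a * x $ k + b * y $ k) \<le> real (idx k) * (a * x $ j + b * y $ j)"
      if "idx k = Suc (idx j)" for j k
    proof -
      have "a * (real (idx j) * x $ k) + b * (real (idx j) * y $ k)
          \<le> a * (real (idx k) * x $ j) + b * (real (idx k) * y $ j)"
        using x y ab that by (intro add_mono mult_left_mono) (auto simp: C_def)
      then show ?thesis by (simp add: algebra_simps)
    qed
    then show "a *\<^sub>R x + b *\<^sub>R y \<in> C"
      using x y ab by (auto simp: C_def)
  qed
  moreover have "lam idx l \<in> C" if "l \<in> {1..CARD('n)}" for l
    using that by (auto simp: C_def lam_def mult.commute)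
  ultimately have "Q_poly idx \<subseteq> C"
    unfolding Q_poly_def by (intro hull_minimal) auto
  with v show "0 \<le> v $ j" "idx j = 1 \<Longrightarrow> v $ j = 1"
    "idx k = Suc (idx j) \<Longrightarrow> real (idx j) * v $ k \<le> real (idx k) * v $ j"
    by (auto simp: C_def)
qed

text \<open>Summation by parts: the normalized ratios \<open>c l\<close> decrease from 1 to 0, so
  their successive differences are convex weights for the points \<open>lam idx l\<close>, and each
  coordinate telescopes.\<close>

lemma Q_poly_memberI:
  fixes idx :: "'n::finite \<Rightarrow> nat"
  assumes bij: "bij_betw idx UNIV {1..CARD('n)}"
    and f: "f \<in> anti_lecture_hall t (CARD('n))" "f 1 = t" and "t \<ge> 1"
  shows "\<exists>v\<in>Q_poly idx. (\<chi> j. real (f (idx j))) = real t *\<^sub>R v"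
proof -
  let ?n = "CARD('n)"
  define c where "c l = real (f l) / real l / real t" for l
  have c: "c (Suc l) \<le> c l" if "1 \<le> l" for l
  proof -
    have "real (l * f (Suc l)) \<le> real (Suc l * f l)"
      using f by (subst of_nat_le_iff) (auto simp: anti_lecture_hall_def)
    then have "real (f (Suc l)) / real (Suc l) \<le> real (f l) / real l"
      using that by (simp add: divide_le_eq pos_le_divide_eq algebra_simps)
    then show ?thesis
      unfolding c_def by (rule divide_right_mono) simp
  qed
  have tele: "(\<Sum>l=m..?n. c l - c (Suc l)) = c m" if "m \<le> ?n" for m
  proof -
    have "(\<Sum>l=m..?n. c l - c (Suc l)) = c m - c (Suc ?n)"
      using sum_Suc_diff[of m ?n "\<lambda>l. - c l"] that by simp
    \<comment> \<open>The zero padding makes the telescoping sum end in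
      \<open>c (Suc ?n) = 0\<close>.\<close>
    moreover have "f (Suc ?n) = 0" using f by (auto simp: anti_lecture_hall_def)
    ultimately show ?thesis by (simp add: c_def)
  qed
  define v where "v = (\<Sum>l=1..?n. (c l - c (Suc l)) *\<^sub>R lam idx l)"
  have "v \<in> Q_poly idx"
    unfolding v_def Q_poly_def
  proof (rule convex_sum)
    have "1 \<le> ?n" by (simp add: Suc_leI)
    then show "(\<Sum>l=1..?n. c l - c (Suc l)) = 1"
      using tele[of 1] f \<open>t \<ge> 1\<close> by (simp add: c_def)
  qed (auto intro: c hull_inc)
  moreover have "v $ j = real (f (idx j)) / real t" for j
  proof -
    have j: "1 \<le> idx j" "idx j \<le> ?n" using bij_betwE[OF bij] by auto
    have "v $ j = (\<Sum>l=1..?n. if idx j \<le> l then (c l - c (Suc l)) * real (idx j) else 0)"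
      by (simp add: v_def lam_def if_distrib cong: if_cong)
    also have "\<dots> = (\<Sum>l=idx j..?n. (c l - c (Suc l)) * real (idx j))"
      by (subst sum.inter_filter[symmetric]) (use j in \<open>auto intro!: sum.cong\<close>)
    also have "\<dots> = c (idx j) * real (idx j)"
      using tele[of "idx j"] j by (simp add: sum_distrib_right[symmetric])
    finally show ?thesis using j by (simp add: c_def)
  qed
  ultimately show ?thesis
    using \<open>t \<ge> 1\<close> by (intro bexI[of _ v]) (auto simp: vec_eq_iff)
qed

lemma Q_poly_lattice_points:
  fixes idx :: "'n::finite \<Rightarrow> nat"
  assumes bij: "bij_betw idx UNIV {1..CARD('n)}" and "t \<ge> 1"
  shows "{x \<in> (\<lambda>y. real t *\<^sub>R y) ` Q_poly idx. \<forall>i. x $ i \<in> \<int>}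
    = (\<lambda>f. \<chi> j. real (f (idx j))) ` {f \<in> anti_lecture_hall t (CARD('n)). f 1 = t}"
    (is "?L = ?h ` ?A")
proof (intro set_eqI iffI)
  fix x assume "x \<in> ?h ` ?A"
  then obtain f where f: "f \<in> anti_lecture_hall t (CARD('n))" "f 1 = t" and x: "x = ?h f"
    by auto
  show "x \<in> ?L"
    using Q_poly_memberI[OF bij f \<open>t \<ge> 1\<close>] by (auto simp: x)
next
  let ?n = "CARD('n)"
  fix x assume "x \<in> ?L"
  then obtain v where v: "v \<in> Q_poly idx" and x: "x = real t *\<^sub>R v" and int: "\<And>i. x $ i \<in> \<int>"
    by auto
  have "\<exists>i. idx i = k" if "1 \<le> k" "k \<le> ?n" for k
    using bij that by (auto simp: bij_betw_def image_iff set_eq_iff) (metis atLeastAtMost_iff)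
  then obtain g where g: "\<And>k. 1 \<le> k \<Longrightarrow> k \<le> ?n \<Longrightarrow> idx (g k) = k" by metis
  have inj: "inj idx" using bij by (simp add: bij_betw_def)
  have idx: "1 \<le> idx j" "idx j \<le> ?n" for j using bij_betwE[OF bij] by auto
  have g_idx: "g (idx j) = j" for j
    using g[OF idx[of j]] inj by (simp add: inj_eq)
  note ineq = Q_poly_inequalities[OF bij v]
  \<comment> \<open>\<open>g\<close> inverts \<open>idx\<close>. The floor and \<open>nat\<close>
    lose nothing, as the coordinates are nonnegative integers.\<close>
  define f where "f k = (if 1 \<le> k \<and> k \<le> ?n then nat \<lfloor>x $ g k\<rfloor> else 0)" for k
  have f: "real (f k) = x $ g k" if "1 \<le> k" "k \<le> ?n" for k
  proof -
    have "0 \<le> x $ g k" using ineq(1) by (simp add: x)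
    then show ?thesis using that int[of "g k"] by (auto simp: f_def elim: Ints_cases)
  qed
  have n1: "1 \<le> ?n" by (simp add: Suc_leI)
  have "real (f 1) = real t" using f[of 1] n1 ineq(2)[of "g 1"] g[of 1] by (simp add: x)
  then have f1: "f 1 = t" by simp
  have chain: "j * f (Suc j) \<le> Suc j * f j" for j
  proof (cases "1 \<le> j \<and> Suc j \<le> ?n")
    case True
    have "real j * v $ g (Suc j) \<le> real (Suc j) * v $ g j"
      using ineq(3)[of "g (Suc j)" "g j"] True g by simp
    then have "real t * (real j * v $ g (Suc j)) \<le> real t * (real (Suc j) * v $ g j)"
      by (rule mult_left_mono) simp
    then have "real (j * f (Suc j)) \<le> real (Suc j * f j)"
      using True f[of j] f[of "Suc j"] by (simp add: x algebra_simps)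
    then show ?thesis by (simp only: of_nat_le_iff)
  next
    \<comment> \<open>Either \<open>j = 0\<close> or \<open>f (Suc j)\<close> is padding, so the
      left side is 0.\<close>
    case False
    then show ?thesis by (auto simp: f_def)
  qed
  have "f j \<le> j * t" for j
    using le_times_first[OF chain, of j] f1 by (simp add: f_def)
  then have "f \<in> ?A" using chain f1 by (auto simp: anti_lecture_hall_def f_def)
  moreover have "x = ?h f" using f idx by (simp add: vec_eq_iff g_idx)
  ultimately show "x \<in> ?h ` ?A" by blast
qed

lemma Ehr_Q_poly:
  fixes idx :: "'n::finite \<Rightarrow> nat"
  assumes bij: "bij_betw idx UNIV {1..CARD('n)}" and "t \<ge> 1"
  shows "Ehr (Q_poly idx) t = (t + 1) ^ CARD('n) - t ^ CARD('n)"
proof -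
  have "inj_on (\<lambda>f. \<chi> j. real (f (idx j)) :: real^'n)
      {f \<in> anti_lecture_hall t (CARD('n)). f 1 = t}"
  proof (rule inj_onI)
    fix f g
    assume fg: "f \<in> {f \<in> anti_lecture_hall t (CARD('n)). f 1 = t}"
        "g \<in> {f \<in> anti_lecture_hall t (CARD('n)). f 1 = t}"
      and eq: "(\<chi> j. real (f (idx j)) :: real^'n) = (\<chi> j. real (g (idx j)))"
    have "f k = g k" for k
    proof (cases "k \<in> {1..CARD('n)}")
      case True
      then obtain j where "idx j = k" using bij by (metis bij_betw_imp_surj_on image_iff)
      with eq show ?thesis by (auto simp: vec_eq_iff)
    next
      case False
      then have "k = 0 \<or> k > CARD('n)" by auto
      \<comment> \<open>Index 0 is not a coordinate; the bound there forces the value 0.\<close>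
      moreover have "f 0 \<le> 0 * t" "g 0 \<le> 0 * t"
        using fg unfolding anti_lecture_hall_def by blast+
      ultimately show ?thesis using fg by (auto simp: anti_lecture_hall_def)
    qed
    then show "f = g" by auto
  qed
  then have "Ehr (Q_poly idx) t = card {f \<in> anti_lecture_hall t (CARD('n)). f 1 = t}"
    unfolding Ehr_def Q_poly_lattice_points[OF assms] by (rule card_image)
  also have "\<dots> = (t + 1) ^ CARD('n) - t ^ CARD('n)"
    using \<open>t \<ge> 1\<close> by (intro card_anti_lecture_hall_tight) (simp_all add: Suc_leI)
  finally show ?thesis .
qed

section \<open>The unimodular map from \<open>Q_poly\<close> onto \<open>P_poly\<close>\<close>

text \<open>The transpose of the matrix \<open>U\<close>, acting on column vectors.\<close>

definition pascal :: "('n::finite \<Rightarrow> nat) \<Rightarrow> real ^ 'n ^ 'n" where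
  "pascal idx = (\<chi> j i. real ((idx i - 1) choose (idx j - 1)))"

text \<open>Back substitution: coordinate \<open>j\<close> of the image is \<open>v $ j\<close> plus
  an integer combination of entries at larger positions, so the induction descends from the largest
  position.\<close>

lemma pascal_integral_imp_integral:
  fixes idx :: "'n::finite \<Rightarrow> nat"
  assumes "inj idx" "\<And>i. 1 \<le> idx i" and int: "\<And>i. (pascal idx *v v) $ i \<in> \<int>"
  shows "v $ j \<in> \<int>"
proof (induction "Max (range idx) - idx j" arbitrary: j rule: less_induct)
  case less
  have "real ((idx i - 1) choose (idx j - 1)) * v $ i \<in> \<int>" if "i \<noteq> j" for i
  proof (cases "idx i < idx j")
    case True
    then have "idx i - 1 < idx j - 1" using assms(2)[of i] by linarith
    then show ?thesis by (simp add: binomial_eq_0)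
  next
    case False
    with that \<open>inj idx\<close> have "idx j < idx i" by (metis injD linorder_neqE_nat)
    moreover have "idx i \<le> Max (range idx)" by simp
    ultimately have "v $ i \<in> \<int>" by (intro less) linarith
    then show ?thesis by simp
  qed
  then have "(\<Sum>i\<in>UNIV - {j}. real ((idx i - 1) choose (idx j - 1)) * v $ i) \<in> \<int>"
    by (intro Ints_sum) auto
  moreover have "(pascal idx *v v) $ j
      = v $ j + (\<Sum>i\<in>UNIV - {j}. real ((idx i - 1) choose (idx j - 1)) * v $ i)"
    by (simp add: pascal_def matrix_vector_mult_def sum.remove[of _ j])
  ultimately show ?case using Ints_diff[OF int[of j]] by fastforce
qed

text \<open>A nonzero kernel vector could be rescaled to have a coordinate 1/2, although its image 0
  is integral.\<close>

lemma pascal_inj: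
  fixes idx :: "'n::finite \<Rightarrow> nat"
  assumes "inj idx" "\<And>i. 1 \<le> idx i"
  shows "inj ((*v) (pascal idx))"
proof -
  have "v = 0" if "pascal idx *v v = 0" for v :: "real^'n"
  proof (rule ccontr)
    assume "v \<noteq> 0"
    then obtain j where j: "v $ j \<noteq> 0" by (auto simp: vec_eq_iff)
    \<comment> \<open>The kernel is a subspace contained in the lattice, hence trivial.\<close>
    have "(inverse (2 * v $ j) *\<^sub>R v) $ j \<in> \<int>"
      by (rule pascal_integral_imp_integral[OF assms]) (simp add: matrix_vector_mult_scaleR that)
    with j have "(1 / 2 :: real) \<in> \<int>" by (simp add: field_simps)
    then show False by simp
  qed
  then show ?thesis by (simp add: linear_injective_0)
qed

lemma Omega_row_eq:
  fixes idx :: "'n::finite \<Rightarrow> nat"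
  assumes bij: "bij_betw idx UNIV {1..CARD('n)}"
  shows "row i (Omega idx) = pascal idx *v lam idx (idx i)"
proof -
  have "(pascal idx *v lam idx (idx i)) $ j = Omega idx $ i $ j" for j
  proof -
    have j: "1 \<le> idx j" and i: "idx i \<le> CARD('n)" using bij_betwE[OF bij] by auto
    have absorb: "((k - 1) choose (idx j - 1)) * k = idx j * (k choose idx j)" if "1 \<le> k" for k
      using binomial_absorption[of "idx j - 1" k] j that by (simp add: mult.commute)
    have "(pascal idx *v lam idx (idx i)) $ j
        = (\<Sum>m\<in>UNIV. real (if idx m \<le> idx i then ((idx m - 1) choose (idx j - 1)) * idx m else 0))"
      by (auto simp: pascal_def lam_def matrix_vector_mult_def intro!: sum.cong)
    also have "\<dots> = (\<Sum>k=1..CARD('n).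
        real (if k \<le> idx i then ((k - 1) choose (idx j - 1)) * k else 0))"
      by (rule sum.reindex_bij_betw[OF bij])
    also have "\<dots> = real (\<Sum>k=1..CARD('n). if k \<le> idx i then ((k - 1) choose (idx j - 1)) * k else 0)"
      by (simp only: of_nat_sum)
    also have "(\<Sum>k=1..CARD('n). if k \<le> idx i then ((k - 1) choose (idx j - 1)) * k else 0)
        = (\<Sum>k=1..idx i. ((k - 1) choose (idx j - 1)) * k)"
      by (subst sum.inter_filter[symmetric]) (use i in \<open>auto intro!: sum.cong\<close>)
    also have "\<dots> = (\<Sum>k=1..idx i. idx j * (k choose idx j))"
      by (intro sum.cong refl absorb) auto
    \<comment> \<open>The new term \<open>k = 0\<close> vanishes because \<open>idx j >= 1\<close>;
      the hockey-stick identity needs the full range.\<close>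
    also have "\<dots> = (\<Sum>k\<le>idx i. idx j * (k choose idx j))"
      using j by (intro sum.mono_neutral_left) (auto simp: not_less_eq_eq)
    also have "\<dots> = idx j * ((idx i + 1) choose (idx j + 1))"
      using sum_choose_upper[of "idx j" "idx i"] by (simp add: sum_distrib_left[symmetric] atMost_atLeast0)
    finally show ?thesis by (simp add: Omega_def)
  qed
  then show ?thesis by (simp add: vec_eq_iff row_def)
qed

lemma P_poly_eq_image:
  fixes idx :: "'n::finite \<Rightarrow> nat"
  assumes bij: "bij_betw idx UNIV {1..CARD('n)}"
  shows "P_poly idx = (*v) (pascal idx) ` Q_poly idx"
proof -
  have "rows (Omega idx) = (*v) (pascal idx) ` lam idx ` range idx"
    by (auto simp: rows_def Omega_row_eq[OF bij])
  then show ?thesis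
    using bij by (simp add: P_poly_def Q_poly_def convex_hull_linear_image bij_betw_def)
qed

text \<open>The map \<open>pascal idx\<close> is injective, commutes with dilation, and both
  preserves and reflects integrality, so it matches the lattice points of the two dilates.\<close>

lemma Ehr_P_poly_eq_Q_poly:
  fixes idx :: "'n::finite \<Rightarrow> nat"
  assumes bij: "bij_betw idx UNIV {1..CARD('n)}"
  shows "Ehr (P_poly idx) t = Ehr (Q_poly idx) t"
proof -
  let ?g = "(*v) (pascal idx)"
  have inj: "inj idx" and pos: "1 \<le> idx i" for i
    using bij bij_betwE[OF bij] by (auto simp: bij_betw_def)
  have int: "(\<forall>i. (?g x) $ i \<in> \<int>) \<longleftrightarrow> (\<forall>i. x $ i \<in> \<int>)" for x
    using pascal_integral_imp_integral[OF inj pos, of x]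
    by (auto simp: pascal_def matrix_vector_mult_def intro!: Ints_sum)
  have "(\<lambda>y. real t *\<^sub>R y) ` P_poly idx = ?g ` (\<lambda>y. real t *\<^sub>R y) ` Q_poly idx"
    by (simp add: P_poly_eq_image[OF bij] image_image matrix_vector_mult_scaleR)
  then have "{x \<in> (\<lambda>y. real t *\<^sub>R y) ` P_poly idx. \<forall>i. x $ i \<in> \<int>}
      = ?g ` {x \<in> (\<lambda>y. real t *\<^sub>R y) ` Q_poly idx. \<forall>i. x $ i \<in> \<int>}"
    using int by (simp add: image_def) blast
  then show ?thesis
    unfolding Ehr_def using card_image[OF inj_on_subset[OF pascal_inj[OF inj pos] subset_UNIV]] by simp
qed

theorem mainTheorem13:
  fixes n t :: nat and idx :: "'n::finite \<Rightarrow> nat"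
  assumes "n \<ge> 1" and "t \<ge> 1"
    and "bij_betw idx UNIV {1..n}"
  shows "Ehr (P_poly idx) t = (t + 1) ^ n - t ^ n \<and>
         Ehr (Q_poly idx) t = (t + 1) ^ n - t ^ n"
proof -
  have "n = CARD('n)" using bij_betw_same_card[OF assms(3)] by simp
  with assms show ?thesis by (simp add: Ehr_P_poly_eq_Q_poly Ehr_Q_poly)
qed

end
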